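(* Let $N$ be a finite set, $f \colon 2^N \to \mathbb{R}_{\ge 0}$ a non-negative monotone submodular function, $\mathcal{M} = (N, \mathcal{I})$ a matroid, and $\varepsilon > 0$. Let $\mathrm{OPT} \in \mathcal{I}$ be a set maximizing $f$ over $\mathcal{I}$. Set $$\ell = \left\lceil \frac{1}{2e\varepsilon} \right\rceil.$$ Let $S_{[\ell]} \in \mathcal{I}$ be an output, for this value of the parameter $\ell$, of the Buchbinder--Feldman local search, i.e. a base of $\mathcal{M}$ satisfying the guarantee $$f(S_{[\ell]}) \;\ge\; \bigl(1 - (1+1/\ell)^{-\ell}\bigr)\, f(\mathrm{OPT}) + (1+1/\ell)^{-\ell}\, f(\emptyset).$$ Then $$f(S_{[\ell]}) \;\ge\; \left(1 - \frac{1}{e} - \varepsilon\right) f(\mathrm{OPT}).$$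
   Context: A set function $f \colon 2^N \to \mathbb{R}_{\ge 0}$ is monotone if $f(A) \le f(B)$ whenever $A \subseteq B \subseteq N$, and submodular if $f(A) + f(B) \ge f(A \cup B) + f(A \cap B)$ for all $A, B \subseteq N$. A matroid $\mathcal{M} = (N, \mathcal{I})$ is given by its family $\mathcal{I}$ of independent sets; a base is a maximal independent set. The Buchbinder--Feldman (idealized, non-oblivious) local search algorithm is a deterministic algorithm for maximizing $f$ over $\mathcal{I}$, parameterised by a positive integer $\ell$. The only property of it that is used is the known guarantee that its output $S_{[\ell]}$ is a base of $\mathcal{M}$ satisfying the inequality displayed in the claim's hypothesis. *)

theory Defs
  imports Complex_Main
begin

definition nonneg_on :: "'a set \<Rightarrow> ('a set \<Rightarrow> real) \<Rightarrow> bool" where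
  "nonneg_on N f \<longleftrightarrow> (\<forall>A. A \<subseteq> N \<longrightarrow> 0 \<le> f A)"

definition monotone_set_fun_on :: "'a set \<Rightarrow> ('a set \<Rightarrow> real) \<Rightarrow> bool" where
  "monotone_set_fun_on N f \<longleftrightarrow> (\<forall>A B. A \<subseteq> B \<and> B \<subseteq> N \<longrightarrow> f A \<le> f B)"

definition submodular_on :: "'a set \<Rightarrow> ('a set \<Rightarrow> real) \<Rightarrow> bool" where
  "submodular_on N f \<longleftrightarrow>
     (\<forall>A B. A \<subseteq> N \<and> B \<subseteq> N \<longrightarrow> f A + f B \<ge> f (A \<union> B) + f (A \<inter> B))"

definition matroid :: "'a set \<Rightarrow> 'a set set \<Rightarrow> bool" where
  "matroid N \<I> \<longleftrightarrow>
     finite N \<and> \<I> \<subseteq> Pow N \<and> {} \<in> \<I> \<and>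
     (\<forall>A B. A \<subseteq> B \<and> B \<in> \<I> \<longrightarrow> A \<in> \<I>) \<and>
     (\<forall>A\<in>\<I>. \<forall>B\<in>\<I>. card A < card B \<longrightarrow> (\<exists>x\<in>B - A. insert x A \<in> \<I>))"

definition matroid_base :: "'a set set \<Rightarrow> 'a set \<Rightarrow> bool" where
  "matroid_base \<I> B \<longleftrightarrow> B \<in> \<I> \<and> (\<forall>A\<in>\<I>. B \<subseteq> A \<longrightarrow> A = B)"

end

theory Submission
  imports Defs
begin

text \<open>
  With \<open>x = 1/\<ell>\<close> the claim reduces to \<open>e \<le> (1 + x)^\<ell> (1 + x/2)\<close>, that is to
  \<open>x \<le> ln (1 + x) + x ln (1 + x/2)\<close>. Bounding the two logarithms below by \<open>2x/(2+x)\<close>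
  and \<open>x/(2+x)\<close> gives exactly \<open>(2x + x\<^sup>2)/(2+x) = x\<close>. Hence
  \<open>(1 + 1/\<ell>)^-\<ell> \<le> 1/e + 1/(2e\<ell>) \<le> 1/e + \<epsilon>\<close> by the choice of \<open>\<ell>\<close>.
\<close>

text \<open>The difference of the two sides vanishes at 0 and has nonnegative derivative. The left
  side is the [1/1] Pade approximant of \<open>ln (1 + x)\<close> at 0, so it is exact to second
  order.\<close>

lemma ln_one_plus_ge_pade:
  fixes x :: real
  assumes "0 \<le> x"
  shows "2 * x / (2 + x) \<le> ln (1 + x)"
proof -
  let ?h = "\<lambda>t::real. ln (1 + t) - 2 * t / (2 + t)"
  have "?h 0 \<le> ?h x"
  proof (rule DERIV_nonneg_imp_nondecreasing[OF assms])
    fix t :: real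
    assume t: "0 \<le> t" "t \<le> x"
    have "(?h has_real_derivative 1 / (1 + t) - (2 * (2 + t) - 2 * t) / ((2 + t) * (2 + t))) (at t)"
      using t by (auto intro!: derivative_eq_intros)
    also have "1 / (1 + t) - (2 * (2 + t) - 2 * t) / ((2 + t) * (2 + t)) = t\<^sup>2 / ((1 + t) * (2 + t)\<^sup>2)"
      using t by (simp add: divide_simps) algebra
    finally have "(?h has_real_derivative t\<^sup>2 / ((1 + t) * (2 + t)\<^sup>2)) (at t)" .
    moreover have "0 \<le> t\<^sup>2 / ((1 + t) * (2 + t)\<^sup>2)"
      using t by simp
    ultimately show "\<exists>y. (?h has_real_derivative y) (at t) \<and> 0 \<le> y"
      by blast
  qed
  then show ?thesis by simp
qed

text \<open>This is \<open>ln y \<le> y - 1\<close> at \<open>y = inverse (1 + x)\<close>.\<close>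

lemma ln_one_plus_ge:
  fixes x :: real
  assumes "0 \<le> x"
  shows "x / (1 + x) \<le> ln (1 + x)"
proof -
  have "ln (inverse (1 + x)) \<le> inverse (1 + x) - 1"
    using assms by (intro ln_le_minus_one) simp
  then have "1 - inverse (1 + x) \<le> ln (1 + x)"
    using assms by (simp add: ln_inverse)
  moreover have "x / (1 + x) = 1 - inverse (1 + x)"
    using assms by (simp add: field_simps)
  ultimately show ?thesis by linarith
qed

text \<open>Since \<open>(1 + 1/n)^n\<close> is about \<open>e * (1 - 1/(2*n))\<close> for large
  \<open>n\<close>, the extra factor cancels the leading error term.\<close>

lemma exp_one_le_compound:
  fixes n :: nat
  assumes "0 < n"
  shows "exp 1 \<le> (1 + 1 / real n) ^ n * (1 + 1 / (2 * real n))"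
proof -
  define x where "x = 1 / real n"
  have x: "0 < x" and nx: "real n * x = 1"
    using assms by (simp_all add: x_def)
  have "(x / 2) / (1 + x / 2) = x / (2 + x)"
    using x by (simp add: divide_simps)
  \<comment> \<open>The lower bounds for the two logarithms add up to exactly 1, because
    \<open>real n * x = 1\<close> turns the sum into \<open>(2 + x) / (2 + x)\<close>.\<close>
  then have "real n * (2 * x / (2 + x)) + (x / 2) / (1 + x / 2) = 2 * (real n * x) / (2 + x) + x / (2 + x)"
    by simp
  also have "\<dots> = 1"
    unfolding nx using x by (simp flip: add_divide_distrib)
  finally have "1 \<le> real n * ln (1 + x) + ln (1 + x / 2)"
    using mult_left_mono[OF ln_one_plus_ge_pade[of x], of "real n"] ln_one_plus_ge[of "x / 2"] x
    by simp
  also have "\<dots> = ln ((1 + x) ^ n * (1 + x / 2))"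
    using x by (simp add: ln_mult ln_realpow)
  finally have "exp 1 \<le> (1 + x) ^ n * (1 + x / 2)"
    using x by (simp add: ln_ge_iff)
  then show ?thesis by (simp add: x_def mult.commute)
qed

lemma compound_powi_minus_le:
  fixes n :: nat
  assumes "0 < n"
  shows "(1 + 1 / real n) powi (- int n) \<le> 1 / exp 1 + 1 / (2 * exp 1 * real n)"
proof -
  define P where "P = (1 + 1 / real n) ^ n"
  have "0 < P"
    unfolding P_def by (intro zero_less_power) (simp add: add_pos_nonneg)
  moreover have "exp 1 \<le> P * (1 + 1 / (2 * real n))"
    unfolding P_def by (rule exp_one_le_compound[OF assms])
  ultimately have "inverse P \<le> (1 + 1 / (2 * real n)) / exp 1"
    by (simp add: field_simps)
  also have "\<dots> = 1 / exp 1 + 1 / (2 * exp 1 * real n)"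
    by (simp add: add_divide_distrib mult.commute mult.left_commute)
  finally show ?thesis
    by (simp add: P_def power_int_minus)
qed

theorem proposition2:
  fixes N :: "'a set" and \<I> :: "'a set set"
    and f :: "'a set \<Rightarrow> real"
    and \<epsilon> :: real and l :: nat
    and OPT S :: "'a set"
  assumes "finite N"
    and "nonneg_on N f"
    and "monotone_set_fun_on N f"
    and "submodular_on N f"
    and "matroid N \<I>"
    and "\<epsilon> > 0"
    and "OPT \<in> \<I>"
    and "\<forall>A\<in>\<I>. f A \<le> f OPT"
    and "int l = \<lceil>1 / (2 * exp 1 * \<epsilon>)\<rceil>"
    and "matroid_base \<I> S"
    and "f S \<ge> (1 - (1 + 1 / real l) powi (- int l)) * f OPT
                 + (1 + 1 / real l) powi (- int l) * f {}"
  shows "f S \<ge> (1 - 1 / exp 1 - \<epsilon>) * f OPT"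
proof -
  define a where "a = (1 + 1 / real l) powi (- int l)"
  have "0 < 1 / (2 * exp 1 * \<epsilon>)"
    using \<open>\<epsilon> > 0\<close> by simp
  \<comment> \<open>The case \<open>l = 0\<close> must be excluded: division by zero yields 0 there,
    and the bound on \<open>a\<close> from \<open>compound_powi_minus_le\<close> would read
    \<open>1 \<le> 1 / exp 1\<close>.\<close>
  then have "0 < int l"
    unfolding assms(9) by (simp add: zero_less_ceiling)
  then have l: "0 < l" by simp
  have "1 / (2 * exp 1 * \<epsilon>) \<le> real l"
    using le_of_int_ceiling[of "1 / (2 * exp 1 * \<epsilon>)"] unfolding assms(9)[symmetric] by simp
  then have "1 / (2 * exp 1 * real l) \<le> \<epsilon>"
    using l \<open>\<epsilon> > 0\<close> by (simp add: field_simps)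
  then have a: "a \<le> 1 / exp 1 + \<epsilon>"
    using compound_powi_minus_le[OF l] unfolding a_def by linarith
  \<comment> \<open>Nonnegativity of \<open>f\<close> is given on subsets of \<open>N\<close> only;
    \<open>f OPT\<close> must be nonnegative for the upper bound on \<open>a\<close> to be
    multiplied by it.\<close>
  have "OPT \<subseteq> N"
    using assms(5,7) by (auto simp: matroid_def)
  then have "0 \<le> f OPT" "0 \<le> f {}"
    using assms(2) by (auto simp: nonneg_on_def)
  have "(1 - 1 / exp 1 - \<epsilon>) * f OPT \<le> (1 - a) * f OPT"
    using a \<open>0 \<le> f OPT\<close> by (intro mult_right_mono) linarith
  also have "\<dots> \<le> (1 - a) * f OPT + a * f {}"
    using \<open>0 \<le> f {}\<close> by (simp add: a_def)
  also have "\<dots> \<le> f S"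
    using assms(11) by (simp add: a_def)
  finally show ?thesis .
qed

end
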